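(* Let $R$ be a commutative ring with $1\neq 0$ and let $M$ be a nonzero unital $R$-module. Suppose that either $M$ is meet irreducible and finitely generated and all of its maximal submodules are strongly irreducible, or $M$ is a meet irreducible multiplication module. Then the following statements are equivalent: (i) $\widetilde{G(M)}$ is an indiscrete space; (ii) $G(M)$ is an indiscrete space; (iii) $M$ is a simple module.
   Context: An $R$-module $M$ is meet irreducible if the intersection of any two nonzero submodules of $M$ is nonzero. A submodule $N$ of $M$ is strongly irreducible if whenever $K\cap L\subseteq N$ for submodules $K,L$ of $M$, then $K\subseteq N$ or $L\subseteq N$. $M$ is a multiplication module if every submodule of $M$ has the form $IM$ for some ideal $I$ of $R$. Let $\mathfrak{B}_M$ be the family of all cosets $m+N$ where $m\in M$ and $N$ is a nonzero submodule of $M$ with $N+Rm=M$. Under the stated hypotheses on $M$, $\mathfrak{B}_M$ is a basis for a topology on $M$; the set $M$ with this topology (open sets are the unions of members of $\mathfrak{B}_M$) is denoted $\widetilde{G(M)}$. $G(M)$ denotes $M^{\bullet}=M-\{0\}$ with the subspace topology from $\widetilde{G(M)}$ (the Golomb topology of $M$). A space is indiscrete if its only open sets are the empty set and the whole space. *)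

theory Defs
  imports "HOL-Algebra.Ideal" "HOL-Algebra.Module" "HOL-Analysis.Abstract_Topology"
begin

definition meet_irreducible_module ::
    "('a, 'c) ring_scheme \<Rightarrow> ('a, 'b, 'd) module_scheme \<Rightarrow> bool" where
  "meet_irreducible_module R M \<longleftrightarrow>
     (\<forall>K L. submodule K R M \<and> submodule L R M \<and> K \<noteq> {\<zero>\<^bsub>M\<^esub>} \<and> L \<noteq> {\<zero>\<^bsub>M\<^esub>}
        \<longrightarrow> K \<inter> L \<noteq> {\<zero>\<^bsub>M\<^esub>})"

definition strongly_irreducible_submodule ::
    "'b set \<Rightarrow> ('a, 'c) ring_scheme \<Rightarrow> ('a, 'b, 'd) module_scheme \<Rightarrow> bool" where
  "strongly_irreducible_submodule N R M \<longleftrightarrow>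
     submodule N R M \<and>
     (\<forall>K L. submodule K R M \<and> submodule L R M \<and> K \<inter> L \<subseteq> N \<longrightarrow> K \<subseteq> N \<or> L \<subseteq> N)"

definition maximal_submodule ::
    "'b set \<Rightarrow> ('a, 'c) ring_scheme \<Rightarrow> ('a, 'b, 'd) module_scheme \<Rightarrow> bool" where
  "maximal_submodule N R M \<longleftrightarrow>
     submodule N R M \<and> N \<noteq> carrier M \<and>
     (\<forall>K. submodule K R M \<and> N \<subseteq> K \<longrightarrow> K = N \<or> K = carrier M)"

definition simple_module ::
    "('a, 'c) ring_scheme \<Rightarrow> ('a, 'b, 'd) module_scheme \<Rightarrow> bool" where
  "simple_module R M \<longleftrightarrow>
     carrier M \<noteq> {\<zero>\<^bsub>M\<^esub>} \<and>
     (\<forall>N. submodule N R M \<longrightarrow> N = {\<zero>\<^bsub>M\<^esub>} \<or> N = carrier M)"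

definition submodule_generated ::
    "('a, 'c) ring_scheme \<Rightarrow> ('a, 'b, 'd) module_scheme \<Rightarrow> 'b set \<Rightarrow> 'b set" where
  "submodule_generated R M S = (\<lambda>N. submodule N R M) hull S"

definition finitely_generated_module ::
    "('a, 'c) ring_scheme \<Rightarrow> ('a, 'b, 'd) module_scheme \<Rightarrow> bool" where
  "finitely_generated_module R M \<longleftrightarrow>
     (\<exists>S. finite S \<and> S \<subseteq> carrier M \<and> submodule_generated R M S = carrier M)"

(* The product IM: the submodule generated by all a m with a in I and m in M. *)
definition ideal_smult ::
    "('a, 'c) ring_scheme \<Rightarrow> ('a, 'b, 'd) module_scheme \<Rightarrow> 'a set \<Rightarrow> 'b set" where
  "ideal_smult R M I = submodule_generated R M {a \<odot>\<^bsub>M\<^esub> m | a m. a \<in> I \<and> m \<in> carrier M}"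

definition multiplication_module ::
    "('a, 'c) ring_scheme \<Rightarrow> ('a, 'b, 'd) module_scheme \<Rightarrow> bool" where
  "multiplication_module R M \<longleftrightarrow>
     (\<forall>N. submodule N R M \<longrightarrow> (\<exists>I. ideal I R \<and> N = ideal_smult R M I))"

definition golomb_basis ::
    "('a, 'c) ring_scheme \<Rightarrow> ('a, 'b, 'd) module_scheme \<Rightarrow> 'b set set" where
  "golomb_basis R M =
     {m <+\<^bsub>M\<^esub> N | m N. m \<in> carrier M \<and> submodule N R M \<and> N \<noteq> {\<zero>\<^bsub>M\<^esub>} \<and>
        N <+>\<^bsub>M\<^esub> {r \<odot>\<^bsub>M\<^esub> m | r. r \<in> carrier R} = carrier M}"

(* The open sets are the unions of members of golomb_basis. The function topology is specified
   only when these unions are closed under binary intersections; without a hypothesis on M that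
   guarantees this, the definition is meaningless. *)
definition golomb_topology_full ::
    "('a, 'c) ring_scheme \<Rightarrow> ('a, 'b, 'd) module_scheme \<Rightarrow> 'b topology" where
  "golomb_topology_full R M = topology (arbitrary union_of (\<lambda>U. U \<in> golomb_basis R M))"

definition golomb_topology ::
    "('a, 'c) ring_scheme \<Rightarrow> ('a, 'b, 'd) module_scheme \<Rightarrow> 'b topology" where
  "golomb_topology R M = subtopology (golomb_topology_full R M) (carrier M - {\<zero>\<^bsub>M\<^esub>})"

definition indiscrete_space :: "'b topology \<Rightarrow> bool" where
  "indiscrete_space X \<longleftrightarrow> (\<forall>U. openin X U \<longrightarrow> U = {} \<or> U = topspace X)"

end

theory Submission
  imports Defs "HOL-Algebra.Ring_Divisibility"
begin

text \<open>
  Call a submodule \<open>N\<close> comaximal with \<open>m\<close> if \<open>N + Rm = M\<close>; the basic open sets are the cosets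
  \<open>m + N\<close> of nonzero \<open>N\<close> comaximal with \<open>m\<close>.

  If \<open>M\<close> is simple, the only nonzero submodule is \<open>M\<close> itself, so \<open>M\<close> is the only basic open set
  and both spaces are indiscrete. Indiscreteness passes from \<open>M\<close> to the subspace
  \<open>M - {0}\<close>. What remains is to see that an indiscrete \<open>M - {0}\<close> forces \<open>M\<close> to be simple.
  Suppose it is not simple, and let \<open>N\<close> be a nonzero proper submodule comaximal with some \<open>m\<close>.
  Since \<open>m \<notin> N\<close>, the coset \<open>m + N\<close> avoids both \<open>0\<close> and the nonzero elements of \<open>N\<close>, so it is an
  open subset of \<open>M - {0}\<close> that is neither empty nor everything
  (\<open>simple_if_punctured_indiscrete\<close>).

  Two module-theoretic facts carry this argument, and each has one proof per alternative in the
  hypothesis.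

  The first makes the cosets a basis (\<open>openin_golomb_topology_full\<close>): if \<open>N + X = M\<close> and \<open>N' + X = M\<close>, then
  \<open>(N \<inter> N') + X = M\<close>. For finitely generated \<open>M\<close>, a proper \<open>(N \<inter> N') + X\<close> would lie in a maximal
  submodule \<open>P\<close>; strong irreducibility puts \<open>N\<close> or \<open>N'\<close> inside \<open>P\<close>, and \<open>X \<subseteq> P\<close> then gives
  \<open>P = M\<close>. For a multiplication module write \<open>N = IM\<close>; then \<open>M = IM + X = I(N' + X) + X\<close>,
  and \<open>IN' \<subseteq> N \<inter> N'\<close>. Meet irreducibility keeps \<open>N \<inter> N'\<close> nonzero.

  The second says that a module that is not simple has a nonzero proper submodule comaximal
  with some element. For finitely generated \<open>M\<close> a maximal submodule above a given one will do.
  A multiplication module may fail to be finitely generated, so Zorn's lemma is applied to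
  ideals instead: for \<open>y \<notin> N\<close> take a maximal ideal \<open>P\<close> above the colon ideal \<open>(N : y)\<close>. Then
  \<open>PM + N\<close> is proper, for otherwise \<open>Ry = IM = I(PM + N) \<subseteq> Py + N\<close>, which places
  \<open>1 - p\<close> in \<open>(N : y) \<subseteq> P\<close> for some \<open>p \<in> P\<close>. Every \<open>m\<close> outside \<open>PM + N\<close> is comaximal with it:
  \<open>Rm = JM\<close> with \<open>J\<close> not contained in \<open>P\<close>, so \<open>P + J = R\<close> and \<open>PM + Rm = M\<close>
  (\<open>ideal_smult_sum_proper\<close>, \<open>comaximal_above_multiplication\<close>).
\<close>

section \<open>Sums, cyclic submodules and colon ideals\<close>

abbreviation cyclic_submodule ::
    "('a, 'c) ring_scheme \<Rightarrow> ('a, 'b, 'd) module_scheme \<Rightarrow> 'b \<Rightarrow> 'b set" where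
  "cyclic_submodule R M m \<equiv> {r \<odot>\<^bsub>M\<^esub> m | r. r \<in> carrier R}"

definition colon_ideal ::
    "('a, 'c) ring_scheme \<Rightarrow> ('a, 'b, 'd) module_scheme \<Rightarrow> 'b set \<Rightarrow> 'b \<Rightarrow> 'a set" where
  "colon_ideal R M N y = {r \<in> carrier R. r \<odot>\<^bsub>M\<^esub> y \<in> N}"

context Module.module
begin

lemma submodule_zero:
  assumes N: "submodule N R M"
  shows "\<zero>\<^bsub>M\<^esub> \<in> N"
proof -
  obtain x where x: "x \<in> N"
    using submoduleE(2)[OF N] by blast
  then have "x \<oplus>\<^bsub>M\<^esub> \<ominus>\<^bsub>M\<^esub> x \<in> N"
    by (intro submoduleE(5)[OF N] submoduleE(3)[OF N])
  then show ?thesis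
    using x submoduleE(1)[OF N] by (simp add: M.r_neg subset_iff)
qed

lemma submodule_minus:
  assumes "submodule N R M" "x \<in> N" "y \<in> N"
  shows "x \<ominus>\<^bsub>M\<^esub> y \<in> N"
  unfolding a_minus_def using assms(2,3)
  by (intro submoduleE(5)[OF assms(1)] submoduleE(3)[OF assms(1)])

lemma submodule_add_cancel:
  assumes N: "submodule N R M" and "m \<in> carrier M" "n \<in> N" "m \<oplus>\<^bsub>M\<^esub> n \<in> N"
  shows "m \<in> N"
proof -
  have n: "n \<in> carrier M"
    using submoduleE(1)[OF N] assms by blast
  have "m = (m \<oplus>\<^bsub>M\<^esub> n) \<ominus>\<^bsub>M\<^esub> n"
    using assms(2) n by (simp add: M.minus_eq M.a_assoc M.r_neg)
  then show ?thesis
    using submodule_minus[OF N assms(4,3)] by simp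
qed

lemma submodule_Inter:
  assumes ne: "\<A> \<noteq> {}" and sub: "\<And>N. N \<in> \<A> \<Longrightarrow> submodule N R M"
  shows "submodule (\<Inter>\<A>) R M"
proof (rule submoduleI)
  show "\<Inter>\<A> \<subseteq> carrier M"
    using ne submoduleE(1)[OF sub] by blast
  show "\<zero>\<^bsub>M\<^esub> \<in> \<Inter>\<A>"
    using submodule_zero[OF sub] by (intro InterI)
  show "\<ominus>\<^bsub>M\<^esub> a \<in> \<Inter>\<A>" if "a \<in> \<Inter>\<A>" for a
    by (rule InterI) (rule submoduleE(3)[OF sub InterD[OF that]])
  show "a \<oplus>\<^bsub>M\<^esub> b \<in> \<Inter>\<A>" if "a \<in> \<Inter>\<A>" "b \<in> \<Inter>\<A>" for a b
    by (rule InterI) (rule submoduleE(5)[OF sub InterD[OF that(1)] InterD[OF that(2)]])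
  show "r \<odot>\<^bsub>M\<^esub> a \<in> \<Inter>\<A>" if "r \<in> carrier R" "a \<in> \<Inter>\<A>" for r a
    by (rule InterI) (rule submoduleE(4)[OF sub that(1) InterD[OF that(2)]])
qed

lemma submodule_Int:
  assumes "submodule N R M" "submodule K R M"
  shows "submodule (N \<inter> K) R M"
  using submodule_Inter[of "{N, K}"] assms by auto

lemma set_addI: "n \<in> N \<Longrightarrow> k \<in> K \<Longrightarrow> n \<oplus>\<^bsub>M\<^esub> k \<in> N <+>\<^bsub>M\<^esub> K"
  unfolding set_add_def' by blast

lemma set_addE:
  assumes "a \<in> N <+>\<^bsub>M\<^esub> K"
  obtains n k where "n \<in> N" "k \<in> K" "a = n \<oplus>\<^bsub>M\<^esub> k"
  using assms unfolding set_add_def' by blast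

lemma submodule_sum:
  assumes N: "submodule N R M" and K: "submodule K R M"
  shows "submodule (N <+>\<^bsub>M\<^esub> K) R M"
proof (rule submoduleI)
  note [simp] = subsetD[OF submoduleE(1)[OF N]] subsetD[OF submoduleE(1)[OF K]]
  show "N <+>\<^bsub>M\<^esub> K \<subseteq> carrier M"
    by (auto elim!: set_addE)
  show "\<zero>\<^bsub>M\<^esub> \<in> N <+>\<^bsub>M\<^esub> K"
    using set_addI[OF submodule_zero[OF N] submodule_zero[OF K]] by simp
  show "\<ominus>\<^bsub>M\<^esub> a \<in> N <+>\<^bsub>M\<^esub> K" if a: "a \<in> N <+>\<^bsub>M\<^esub> K" for a
  proof -
    obtain n k where nk: "n \<in> N" "k \<in> K" "a = n \<oplus>\<^bsub>M\<^esub> k"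
      using a by (rule set_addE)
    then have "\<ominus>\<^bsub>M\<^esub> a = \<ominus>\<^bsub>M\<^esub> n \<oplus>\<^bsub>M\<^esub> \<ominus>\<^bsub>M\<^esub> k"
      by (simp add: M.minus_add)
    also have "\<dots> \<in> N <+>\<^bsub>M\<^esub> K"
      using nk by (intro set_addI submoduleE(3)[OF N] submoduleE(3)[OF K])
    finally show ?thesis .
  qed
  show "a \<oplus>\<^bsub>M\<^esub> b \<in> N <+>\<^bsub>M\<^esub> K" if ab: "a \<in> N <+>\<^bsub>M\<^esub> K" "b \<in> N <+>\<^bsub>M\<^esub> K" for a b
  proof -
    obtain n k where nk: "n \<in> N" "k \<in> K" "a = n \<oplus>\<^bsub>M\<^esub> k"
      using ab(1) by (rule set_addE)
    obtain n' k' where nk': "n' \<in> N" "k' \<in> K" "b = n' \<oplus>\<^bsub>M\<^esub> k'"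
      using ab(2) by (rule set_addE)
    have "a \<oplus>\<^bsub>M\<^esub> b = (n \<oplus>\<^bsub>M\<^esub> n') \<oplus>\<^bsub>M\<^esub> (k \<oplus>\<^bsub>M\<^esub> k')"
      using nk nk' by (simp add: M.a_ac)
    also have "\<dots> \<in> N <+>\<^bsub>M\<^esub> K"
      using nk nk' by (intro set_addI submoduleE(5)[OF N] submoduleE(5)[OF K])
    finally show ?thesis .
  qed
  show "r \<odot>\<^bsub>M\<^esub> a \<in> N <+>\<^bsub>M\<^esub> K" if r: "r \<in> carrier R" and a: "a \<in> N <+>\<^bsub>M\<^esub> K" for r a
  proof -
    obtain n k where nk: "n \<in> N" "k \<in> K" "a = n \<oplus>\<^bsub>M\<^esub> k"
      using a by (rule set_addE)
    then have "r \<odot>\<^bsub>M\<^esub> a = r \<odot>\<^bsub>M\<^esub> n \<oplus>\<^bsub>M\<^esub> r \<odot>\<^bsub>M\<^esub> k"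
      using r by (simp add: smult_r_distr)
    also have "\<dots> \<in> N <+>\<^bsub>M\<^esub> K"
      using nk r by (intro set_addI submoduleE(4)[OF N] submoduleE(4)[OF K])
    finally show ?thesis .
  qed
qed

lemma left_subset_sum:
  assumes N: "submodule N R M" and K: "submodule K R M"
  shows "N \<subseteq> N <+>\<^bsub>M\<^esub> K"
proof
  fix n assume n: "n \<in> N"
  then show "n \<in> N <+>\<^bsub>M\<^esub> K"
    using set_addI[OF n submodule_zero[OF K]] submoduleE(1)[OF N] by (simp add: subset_iff)
qed

lemma right_subset_sum:
  assumes N: "submodule N R M" and K: "submodule K R M"
  shows "K \<subseteq> N <+>\<^bsub>M\<^esub> K"
proof
  fix k assume k: "k \<in> K"
  then show "k \<in> N <+>\<^bsub>M\<^esub> K"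
    using set_addI[OF submodule_zero[OF N] k] submoduleE(1)[OF K] by (simp add: subset_iff)
qed

lemma sum_subset_submodule:
  assumes "submodule Q R M" "N \<subseteq> Q" "K \<subseteq> Q"
  shows "N <+>\<^bsub>M\<^esub> K \<subseteq> Q"
  using assms(2,3) by (auto elim!: set_addE intro!: submoduleE(5)[OF assms(1)])

text \<open>
  Covers both the cyclic submodules \<open>Ry\<close> and the submodules \<open>Py\<close> of the Nakayama-type argument
  below.
\<close>

lemma submodule_ideal_orbit:
  assumes P: "ideal P R" and y: "y \<in> carrier M"
  shows "submodule {p \<odot>\<^bsub>M\<^esub> y | p. p \<in> P} R M" (is "submodule ?Py R M")
proof (rule submoduleI)
  have orbitI: "p \<odot>\<^bsub>M\<^esub> y \<in> ?Py" if "p \<in> P" for p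
    using that by blast
  note PR = ideal.Icarr[OF P]
  note addP = ideal.axioms(1)[OF P]
  show "?Py \<subseteq> carrier M"
  proof
    fix x assume "x \<in> ?Py"
    then obtain p where "p \<in> P" "x = p \<odot>\<^bsub>M\<^esub> y" by blast
    then show "x \<in> carrier M" using PR y by simp
  qed
  show "\<zero>\<^bsub>M\<^esub> \<in> ?Py"
    using orbitI[OF additive_subgroup.zero_closed[OF addP]] smult_l_null[OF y] by simp
  show "\<ominus>\<^bsub>M\<^esub> a \<in> ?Py" if a: "a \<in> ?Py" for a
  proof -
    obtain p where p: "p \<in> P" "a = p \<odot>\<^bsub>M\<^esub> y"
      using a by blast
    have "(\<ominus> p) \<odot>\<^bsub>M\<^esub> y = \<ominus>\<^bsub>M\<^esub> a"
      using smult_l_minus[OF PR[OF p(1)] y] p(2) by simp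
    then show ?thesis
      using orbitI[OF additive_subgroup.a_inv_closed[OF addP p(1)]] by simp
  qed
  show "a \<oplus>\<^bsub>M\<^esub> b \<in> ?Py" if ab: "a \<in> ?Py" "b \<in> ?Py" for a b
  proof -
    obtain p q where pq: "p \<in> P" "a = p \<odot>\<^bsub>M\<^esub> y" "q \<in> P" "b = q \<odot>\<^bsub>M\<^esub> y"
      using ab by blast
    have "(p \<oplus> q) \<odot>\<^bsub>M\<^esub> y = a \<oplus>\<^bsub>M\<^esub> b"
      using smult_l_distr[OF PR[OF pq(1)] PR[OF pq(3)] y] pq by simp
    then show ?thesis
      using orbitI[OF additive_subgroup.a_closed[OF addP pq(1,3)]] by simp
  qed
  show "r \<odot>\<^bsub>M\<^esub> a \<in> ?Py" if r: "r \<in> carrier R" and a: "a \<in> ?Py" for r a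
  proof -
    obtain p where p: "p \<in> P" "a = p \<odot>\<^bsub>M\<^esub> y"
      using a by blast
    have "(r \<otimes> p) \<odot>\<^bsub>M\<^esub> y = r \<odot>\<^bsub>M\<^esub> a"
      using smult_assoc1[OF r PR[OF p(1)] y] p by simp
    then show ?thesis
      using orbitI[OF ideal.I_l_closed[OF P p(1) r]] by simp
  qed
qed

lemma submodule_cyclic:
  assumes "m \<in> carrier M"
  shows "submodule (cyclic_submodule R M m) R M"
  by (rule submodule_ideal_orbit[OF R.oneideal assms])

lemma cyclic_self: "m \<in> carrier M \<Longrightarrow> m \<in> cyclic_submodule R M m"
  using R.one_closed smult_one by force

lemma cyclic_subset_submodule:
  assumes "submodule N R M" "m \<in> N"
  shows "cyclic_submodule R M m \<subseteq> N"
  using submoduleE(4)[OF assms(1) _ assms(2)] by blast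

lemma submodule_generated_least:
  assumes "submodule N R M" "S \<subseteq> N"
  shows "submodule_generated R M S \<subseteq> N"
  unfolding submodule_generated_def using assms by (rule hull_minimal[rotated])

lemma ideal_smult_subset_submodule:
  assumes "submodule N R M" "\<And>a m. a \<in> I \<Longrightarrow> m \<in> carrier M \<Longrightarrow> a \<odot>\<^bsub>M\<^esub> m \<in> N"
  shows "ideal_smult R M I \<subseteq> N"
  unfolding ideal_smult_def by (rule submodule_generated_least) (use assms in auto)

lemma smult_in_ideal_smult:
  assumes "a \<in> I" "m \<in> carrier M"
  shows "a \<odot>\<^bsub>M\<^esub> m \<in> ideal_smult R M I"
  unfolding ideal_smult_def submodule_generated_def by (rule subsetD[OF hull_subset]) (use assms in auto)

lemma submodule_ideal_smult:
  assumes I: "I \<subseteq> carrier R"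
  shows "submodule (ideal_smult R M I) R M"
proof -
  have "{a \<odot>\<^bsub>M\<^esub> m |a m. a \<in> I \<and> m \<in> carrier M} \<subseteq> carrier M"
    using I by auto
  then show ?thesis
    unfolding ideal_smult_def submodule_generated_def hull_def
    by (intro submodule_Inter) (use carrier_is_submodule in auto)
qed

text \<open>
  Since \<open>a\<close> acts linearly, the elements sent into \<open>Q\<close> form a submodule. To show
  \<open>a(N + X) \<subseteq> Q\<close> it is therefore enough to treat \<open>N\<close> and \<open>X\<close> separately, and if \<open>N = PM\<close>, only
  the generators of \<open>PM\<close>.
\<close>

lemma submodule_smult_preimage:
  assumes a: "a \<in> carrier R" and Q: "submodule Q R M"
  shows "submodule {m \<in> carrier M. a \<odot>\<^bsub>M\<^esub> m \<in> Q} R M"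
proof (rule submoduleI)
  show "\<zero>\<^bsub>M\<^esub> \<in> {m \<in> carrier M. a \<odot>\<^bsub>M\<^esub> m \<in> Q}"
    using a submodule_zero[OF Q] by simp
  show "r \<odot>\<^bsub>M\<^esub> x \<in> {m \<in> carrier M. a \<odot>\<^bsub>M\<^esub> m \<in> Q}"
    if r: "r \<in> carrier R" and x: "x \<in> {m \<in> carrier M. a \<odot>\<^bsub>M\<^esub> m \<in> Q}" for r x
  proof -
    have "a \<odot>\<^bsub>M\<^esub> (r \<odot>\<^bsub>M\<^esub> x) = r \<odot>\<^bsub>M\<^esub> (a \<odot>\<^bsub>M\<^esub> x)"
      using a r x by (simp add: smult_assoc1[symmetric] R.m_comm)
    then show ?thesis
      using r x submoduleE(4)[OF Q] by auto
  qed
qed (use a submoduleE(3,5)[OF Q] in \<open>auto simp: smult_r_distr smult_r_minus\<close>)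

lemma ideal_colon:
  assumes N: "submodule N R M" and y: "y \<in> carrier M"
  shows "ideal (colon_ideal R M N y) R"
proof (rule idealI)
  show "ring R" by (rule R.ring_axioms)
  show "subgroup (colon_ideal R M N y) (add_monoid R)"
  proof (rule R.add.subgroupI)
    show "colon_ideal R M N y \<noteq> {}"
      using submodule_zero[OF N] y unfolding colon_ideal_def
      by (metis (mono_tags, lifting) R.zero_closed empty_iff mem_Collect_eq smult_l_null)
  qed (use y submoduleE(3,5)[OF N] in
      \<open>auto simp: colon_ideal_def smult_l_minus smult_l_distr\<close>)
  show *: "x \<otimes> a \<in> colon_ideal R M N y" if "a \<in> colon_ideal R M N y" "x \<in> carrier R" for a x
    using that y submoduleE(4)[OF N] by (auto simp: colon_ideal_def smult_assoc1)
  show "a \<otimes> x \<in> colon_ideal R M N y" if "a \<in> colon_ideal R M N y" "x \<in> carrier R" for a x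
    using *[OF that] that by (simp add: colon_ideal_def R.m_comm)
qed

end

section \<open>Maximal ideals and maximal submodules\<close>

text \<open>
  Zorn's lemma in the form used for ideals, with \<open>S = {\<one>}\<close>, and for submodules, with \<open>S\<close> a
  finite generating set: that \<open>S\<close> is finite keeps "does not contain \<open>S\<close>" closed under unions of
  chains.
\<close>

lemma maximal_avoiding_finite_set:
  assumes fin: "finite S"
    and Union: "\<And>\<C>. \<C> \<noteq> {} \<Longrightarrow> subset.chain \<F> \<C> \<Longrightarrow> \<Union>\<C> \<in> \<F>"
    and N: "N \<in> \<F>" "\<not> S \<subseteq> N"
  shows "\<exists>P\<in>\<F>. N \<subseteq> P \<and> \<not> S \<subseteq> P \<and> (\<forall>K\<in>\<F>. P \<subset> K \<longrightarrow> S \<subseteq> K)"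
proof -
  let ?A = "{K \<in> \<F>. N \<subseteq> K \<and> \<not> S \<subseteq> K}"
  have "\<exists>P\<in>?A. \<forall>X\<in>?A. P \<subseteq> X \<longrightarrow> X = P"
  proof (rule subset_Zorn_nonempty)
    show "?A \<noteq> {}"
      using N by blast
    show "\<Union>\<C> \<in> ?A" if C: "\<C> \<noteq> {}" "subset.chain ?A \<C>" for \<C>
    proof -
      have chain: "subset.chain \<F> \<C>" and sub: "\<C> \<subseteq> ?A"
        using C(2) unfolding subset.chain_def by blast+
      have "\<not> S \<subseteq> \<Union>\<C>"
      proof
        assume "S \<subseteq> \<Union>\<C>"
        then obtain B where "B \<in> \<C>" "S \<subseteq> B"
          using finite_subset_Union_chain[OF fin _ C(1) chain] by blast
        then show False
          using sub by blast
      qed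
      then show ?thesis
        using Union[OF C(1) chain] sub C(1) by blast
    qed
  qed
  then obtain P where P: "P \<in> ?A" and max: "\<forall>X\<in>?A. P \<subseteq> X \<longrightarrow> X = P" ..
  have "S \<subseteq> K" if "K \<in> \<F>" "P \<subset> K" for K
    using P max that by blast
  then show ?thesis
    using P by blast
qed

lemma (in ring) maximalideal_above:
  assumes I: "ideal I R" and one: "\<one> \<notin> I"
  obtains P where "maximalideal P R" "I \<subseteq> P"
proof -
  have "\<exists>P\<in>{I. ideal I R}. I \<subseteq> P \<and> \<not> {\<one>} \<subseteq> P \<and>
      (\<forall>K\<in>{I. ideal I R}. P \<subset> K \<longrightarrow> {\<one>} \<subseteq> K)"
  proof (rule maximal_avoiding_finite_set)
    show "\<Union>\<C> \<in> {I. ideal I R}" if "\<C> \<noteq> {}" "subset.chain {I. ideal I R} \<C>" for \<C>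
      using chain_Union_is_ideal[OF that(2)] that(1) by simp
  qed (use I one in simp_all)
  then obtain P where P: "ideal P R" "I \<subseteq> P" "\<one> \<notin> P"
    and max: "\<And>K. ideal K R \<Longrightarrow> P \<subset> K \<Longrightarrow> \<one> \<in> K"
    by auto
  have "maximalideal P R"
  proof (rule maximalidealI)
    show "carrier R \<noteq> P"
      using P(3) by auto
    show "J = P \<or> J = carrier R" if J: "ideal J R" "P \<subseteq> J" for J
      using max[OF J(1)] J(2) ideal.one_imp_carrier[OF J(1)] by blast
  qed (rule P(1))
  then show thesis
    using that P by blast
qed

context Module.module
begin

lemma submodule_Union_chain:
  assumes ne: "\<C> \<noteq> {}" and chain: "subset.chain {N. submodule N R M} \<C>"
  shows "submodule (\<Union>\<C>) R M"
proof (rule submoduleI)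
  have C: "submodule N R M" if "N \<in> \<C>" for N
    using chain that unfolding subset.chain_def by blast
  show "\<Union>\<C> \<subseteq> carrier M"
    using submoduleE(1)[OF C] by (rule Union_least)
  show "\<zero>\<^bsub>M\<^esub> \<in> \<Union>\<C>"
    using ne submodule_zero[OF C] by blast
  show "\<ominus>\<^bsub>M\<^esub> a \<in> \<Union>\<C>" if a: "a \<in> \<Union>\<C>" for a
  proof -
    obtain A where A: "A \<in> \<C>" "a \<in> A"
      using a by blast
    show ?thesis
      by (rule UnionI[OF A(1) submoduleE(3)[OF C[OF A(1)] A(2)]])
  qed
  show "r \<odot>\<^bsub>M\<^esub> a \<in> \<Union>\<C>" if r: "r \<in> carrier R" and a: "a \<in> \<Union>\<C>" for r a
  proof -
    obtain A where A: "A \<in> \<C>" "a \<in> A"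
      using a by blast
    show ?thesis
      by (rule UnionI[OF A(1) submoduleE(4)[OF C[OF A(1)] r A(2)]])
  qed
  show "a \<oplus>\<^bsub>M\<^esub> b \<in> \<Union>\<C>" if ab: "a \<in> \<Union>\<C>" "b \<in> \<Union>\<C>" for a b
  proof -
    obtain A B where AB: "A \<in> \<C>" "a \<in> A" "B \<in> \<C>" "b \<in> B"
      using ab by blast
    then have "A \<subseteq> B \<or> B \<subseteq> A"
      using chain unfolding subset.chain_def by blast
    then obtain D where D: "D \<in> \<C>" "a \<in> D" "b \<in> D"
      using AB by blast
    show ?thesis
      by (rule UnionI[OF D(1) submoduleE(5)[OF C[OF D(1)] D(2,3)]])
  qed
qed

lemma maximal_submodule_above:
  assumes fg: "finitely_generated_module R M"
    and N: "submodule N R M" "N \<noteq> carrier M"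
  obtains P where "maximal_submodule P R M" "N \<subseteq> P"
proof -
  obtain S where S: "finite S" "S \<subseteq> carrier M" "submodule_generated R M S = carrier M"
    using fg unfolding finitely_generated_module_def by blast
  have S_iff: "S \<subseteq> K \<longleftrightarrow> K = carrier M" if "submodule K R M" for K
  proof
    show "S \<subseteq> K \<Longrightarrow> K = carrier M"
      using submodule_generated_least[OF that, of S] S(3) submoduleE(1)[OF that] by simp
  qed (simp add: S(2))
  have "\<exists>P\<in>{K. submodule K R M}. N \<subseteq> P \<and> \<not> S \<subseteq> P \<and>
      (\<forall>K\<in>{K. submodule K R M}. P \<subset> K \<longrightarrow> S \<subseteq> K)"
  proof (rule maximal_avoiding_finite_set[OF S(1)])
    show "\<Union>\<C> \<in> {K. submodule K R M}"
      if "\<C> \<noteq> {}" "subset.chain {K. submodule K R M} \<C>" for \<C>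
      using submodule_Union_chain[OF that] by simp
  qed (use N S_iff in simp_all)
  then obtain P where P: "submodule P R M" "N \<subseteq> P" "\<not> S \<subseteq> P"
    and max: "\<And>K. submodule K R M \<Longrightarrow> P \<subset> K \<Longrightarrow> S \<subseteq> K"
    by auto
  have "maximal_submodule P R M"
    unfolding maximal_submodule_def
  proof (intro conjI allI impI)
    show "P \<noteq> carrier M"
      using S_iff[OF P(1)] P(3) by simp
    show "K = P \<or> K = carrier M" if K: "submodule K R M \<and> P \<subseteq> K" for K
    proof (cases "K = P")
      case False
      then have "S \<subseteq> K"
        using K by (intro max) auto
      then show ?thesis
        using S_iff K by simp
    qed simp
  qed (rule P(1))
  then show thesis
    using that P by blast
qed

section \<open>Intersections of comaximal submodules\<close>

text \<open>
  A maximal submodule containing both \<open>N \<inter> N'\<close> and \<open>X\<close> would, by strong irreducibility, contain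
  one of \<open>N + X\<close> and \<open>N' + X\<close>, which are both \<open>M\<close>.
\<close>

lemma Int_comaximal_strongly_irreducible:
  assumes fg: "finitely_generated_module R M"
    and si: "\<And>P. maximal_submodule P R M \<Longrightarrow> strongly_irreducible_submodule P R M"
    and sub: "submodule N R M" "submodule N' R M" "submodule X R M"
    and N: "N <+>\<^bsub>M\<^esub> X = carrier M" and N': "N' <+>\<^bsub>M\<^esub> X = carrier M"
  shows "(N \<inter> N') <+>\<^bsub>M\<^esub> X = carrier M"
proof (rule ccontr)
  assume proper: "(N \<inter> N') <+>\<^bsub>M\<^esub> X \<noteq> carrier M"
  note NN' = submodule_Int[OF sub(1,2)]
  obtain P where P: "maximal_submodule P R M" "(N \<inter> N') <+>\<^bsub>M\<^esub> X \<subseteq> P"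
    using maximal_submodule_above[OF fg submodule_sum[OF NN' sub(3)] proper] .
  have P': "submodule P R M" "P \<noteq> carrier M"
    using P(1) unfolding maximal_submodule_def by blast+
  have "N \<inter> N' \<subseteq> P" and X: "X \<subseteq> P"
    using P(2) left_subset_sum[OF NN' sub(3)] right_subset_sum[OF NN' sub(3)] by auto
  then have "N \<subseteq> P \<or> N' \<subseteq> P"
    using si[OF P(1)] sub unfolding strongly_irreducible_submodule_def by blast
  then have "carrier M \<subseteq> P"
    using sum_subset_submodule[OF P'(1) _ X, of N] sum_subset_submodule[OF P'(1) _ X, of N'] N N'
    by auto
  then show False
    using P'(2) submoduleE(1)[OF P'(1)] by simp
qed

text \<open>
  With \<open>N = IM\<close>, multiplying \<open>M = N' + X\<close> by \<open>I\<close> gives \<open>N = IN' + IX \<subseteq> (N \<inter> N') + X\<close>, because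
  \<open>IN'\<close> lies both in \<open>IM = N\<close> and in \<open>N'\<close>.
\<close>

lemma Int_comaximal_multiplication:
  assumes mult: "multiplication_module R M"
    and sub: "submodule N R M" "submodule N' R M" "submodule X R M"
    and N: "N <+>\<^bsub>M\<^esub> X = carrier M" and N': "N' <+>\<^bsub>M\<^esub> X = carrier M"
  shows "(N \<inter> N') <+>\<^bsub>M\<^esub> X = carrier M"
proof -
  let ?Q = "(N \<inter> N') <+>\<^bsub>M\<^esub> X"
  note NN' = submodule_Int[OF sub(1,2)]
  have Q: "submodule ?Q R M" and Int_Q: "N \<inter> N' \<subseteq> ?Q" and X_Q: "X \<subseteq> ?Q"
    using submodule_sum[OF NN' sub(3)] left_subset_sum[OF NN' sub(3)] right_subset_sum[OF NN' sub(3)]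
    by simp_all
  obtain I where I: "ideal I R" and N_eq: "N = ideal_smult R M I"
    using mult sub(1) unfolding multiplication_module_def by blast
  have "ideal_smult R M I \<subseteq> ?Q"
  proof (rule ideal_smult_subset_submodule[OF Q])
    fix a m assume a: "a \<in> I" and m: "m \<in> carrier M"
    have aR: "a \<in> carrier R"
      by (rule ideal.Icarr[OF I a])
    have "N' <+>\<^bsub>M\<^esub> X \<subseteq> {m \<in> carrier M. a \<odot>\<^bsub>M\<^esub> m \<in> ?Q}"
    proof (rule sum_subset_submodule[OF submodule_smult_preimage[OF aR Q]]; rule subsetI)
      fix n assume n: "n \<in> N'"
      then have nM: "n \<in> carrier M"
        using submoduleE(1)[OF sub(2)] by (rule rev_subsetD)
      have "a \<odot>\<^bsub>M\<^esub> n \<in> N \<inter> N'"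
        using smult_in_ideal_smult[OF a nM] submoduleE(4)[OF sub(2) aR n] N_eq by simp
      then show "n \<in> {m \<in> carrier M. a \<odot>\<^bsub>M\<^esub> m \<in> ?Q}"
        using nM Int_Q by (simp add: subset_iff)
    next
      fix x assume x: "x \<in> X"
      then have "x \<in> carrier M"
        using submoduleE(1)[OF sub(3)] by (rule rev_subsetD)
      then show "x \<in> {m \<in> carrier M. a \<odot>\<^bsub>M\<^esub> m \<in> ?Q}"
        using submoduleE(4)[OF sub(3) aR x] X_Q by (simp add: subset_iff)
    qed
    then show "a \<odot>\<^bsub>M\<^esub> m \<in> ?Q"
      using m N' by auto
  qed
  then have "N <+>\<^bsub>M\<^esub> X \<subseteq> ?Q"
    using N_eq by (intro sum_subset_submodule[OF Q _ X_Q]) simp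
  then show ?thesis
    using N submoduleE(1)[OF Q] by simp
qed

section \<open>Nonzero proper comaximal submodules\<close>

lemma maximal_submodule_comaximal:
  assumes P: "maximal_submodule P R M" and m: "m \<in> carrier M" "m \<notin> P"
  shows "P <+>\<^bsub>M\<^esub> cyclic_submodule R M m = carrier M"
proof -
  have sub: "submodule P R M"
    and max: "\<And>K. submodule K R M \<Longrightarrow> P \<subseteq> K \<Longrightarrow> K = P \<or> K = carrier M"
    using P unfolding maximal_submodule_def by simp_all
  note C = submodule_cyclic[OF m(1)]
  have "m \<in> P <+>\<^bsub>M\<^esub> cyclic_submodule R M m"
    by (rule subsetD[OF right_subset_sum[OF sub C] cyclic_self[OF m(1)]])
  then show ?thesis
    using max[OF submodule_sum[OF sub C] left_subset_sum[OF sub C]] m(2) by auto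
qed

lemma comaximal_above_finitely_generated:
  assumes fg: "finitely_generated_module R M" and N: "submodule N R M" "N \<noteq> carrier M"
  shows "\<exists>Q m. submodule Q R M \<and> N \<subseteq> Q \<and> Q \<noteq> carrier M \<and> m \<in> carrier M \<and>
    Q <+>\<^bsub>M\<^esub> cyclic_submodule R M m = carrier M"
proof -
  obtain P where P: "maximal_submodule P R M" "N \<subseteq> P"
    using maximal_submodule_above[OF fg N] .
  then have P': "submodule P R M" "P \<noteq> carrier M"
    unfolding maximal_submodule_def by simp_all
  then obtain m where m: "m \<in> carrier M" "m \<notin> P"
    using submoduleE(1)[OF P'(1)] by blast
  show ?thesis
    by (intro exI conjI) (rule P'(1) P(2) P'(2) m(1) maximal_submodule_comaximal[OF P(1) m])+
qed

text \<open>
  An argument in the style of Nakayama's lemma. If \<open>PM + N = M\<close>, write \<open>Ry = IM\<close> and multiply by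
  \<open>I\<close>: then \<open>Ry = PIM + IN \<subseteq> Py + N\<close>, so \<open>(1 - p)y \<in> N\<close> for some \<open>p \<in> P\<close>, and \<open>P\<close> would contain
  both \<open>p\<close> and \<open>1 - p\<close>. Working with the single element \<open>y\<close> is what replaces a finite set of
  generators of \<open>M\<close>.
\<close>

lemma ideal_smult_sum_proper:
  assumes mult: "multiplication_module R M"
    and N: "submodule N R M" and y: "y \<in> carrier M"
    and P: "ideal P R" "\<one> \<notin> P" "colon_ideal R M N y \<subseteq> P"
  shows "ideal_smult R M P <+>\<^bsub>M\<^esub> N \<noteq> carrier M"
proof
  assume eq: "ideal_smult R M P <+>\<^bsub>M\<^esub> N = carrier M"
  interpret P: ideal P R by (rule P(1))
  obtain I where I: "ideal I R" and Ry: "cyclic_submodule R M y = ideal_smult R M I"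
    using mult submodule_cyclic[OF y] unfolding multiplication_module_def by blast
  define Py where "Py = {p \<odot>\<^bsub>M\<^esub> y | p. p \<in> P}"
  let ?Q = "Py <+>\<^bsub>M\<^esub> N"
  have Py: "submodule Py R M"
    unfolding Py_def by (rule submodule_ideal_orbit[OF P(1) y])
  have Q: "submodule ?Q R M" and Py_Q: "Py \<subseteq> ?Q" and N_Q: "N \<subseteq> ?Q"
    by (rule submodule_sum[OF Py N] left_subset_sum[OF Py N] right_subset_sum[OF Py N])+
  have "ideal_smult R M I \<subseteq> ?Q"
  proof (rule ideal_smult_subset_submodule[OF Q])
    fix a m assume a: "a \<in> I" and m: "m \<in> carrier M"
    have aR: "a \<in> carrier R"
      by (rule ideal.Icarr[OF I a])
    note pre = submodule_smult_preimage[OF aR Q]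
    have "ideal_smult R M P <+>\<^bsub>M\<^esub> N \<subseteq> {m \<in> carrier M. a \<odot>\<^bsub>M\<^esub> m \<in> ?Q}"
    proof (rule sum_subset_submodule[OF pre ideal_smult_subset_submodule[OF pre] subsetI])
      fix p x assume p: "p \<in> P" and x: "x \<in> carrier M"
      have pR: "p \<in> carrier R"
        using p by (rule P.Icarr)
      obtain r where r: "r \<in> carrier R" "a \<odot>\<^bsub>M\<^esub> x = r \<odot>\<^bsub>M\<^esub> y"
        using smult_in_ideal_smult[OF a x] unfolding Ry[symmetric] by blast
      have "a \<odot>\<^bsub>M\<^esub> (p \<odot>\<^bsub>M\<^esub> x) = p \<odot>\<^bsub>M\<^esub> (a \<odot>\<^bsub>M\<^esub> x)"
        using aR pR x by (simp add: smult_assoc1[symmetric] R.m_comm)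
      also have "\<dots> = (p \<otimes> r) \<odot>\<^bsub>M\<^esub> y"
        using r pR y by (simp add: smult_assoc1)
      also have "\<dots> \<in> Py"
        unfolding Py_def using P.I_r_closed[OF p r(1)] by blast
      finally show "p \<odot>\<^bsub>M\<^esub> x \<in> {m \<in> carrier M. a \<odot>\<^bsub>M\<^esub> m \<in> ?Q}"
        using Py_Q pR x by auto
    next
      fix n assume n: "n \<in> N"
      then have "n \<in> carrier M"
        using submoduleE(1)[OF N] by (rule rev_subsetD)
      then show "n \<in> {m \<in> carrier M. a \<odot>\<^bsub>M\<^esub> m \<in> ?Q}"
        using submoduleE(4)[OF N aR n] N_Q by (simp add: subset_iff)
    qed
    then show "a \<odot>\<^bsub>M\<^esub> m \<in> ?Q"
      using m eq by auto
  qed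
  moreover have "y \<in> ideal_smult R M I"
    using cyclic_self[OF y] Ry by simp
  ultimately have "y \<in> ?Q"
    by (rule subsetD)
  then obtain p n where p: "p \<in> P" and n: "n \<in> N" and y_eq: "y = p \<odot>\<^bsub>M\<^esub> y \<oplus>\<^bsub>M\<^esub> n"
    unfolding Py_def set_add_def' by auto
  have pR: "p \<in> carrier R"
    using p by (rule P.Icarr)
  have nM: "n \<in> carrier M"
    using n submoduleE(1)[OF N] by (rule rev_subsetD)
  have "(\<one> \<ominus> p) \<odot>\<^bsub>M\<^esub> y = y \<ominus>\<^bsub>M\<^esub> p \<odot>\<^bsub>M\<^esub> y"
    using pR y by (simp add: R.minus_eq M.minus_eq smult_l_distr smult_l_minus)
  also have "\<dots> = (p \<odot>\<^bsub>M\<^esub> y \<oplus>\<^bsub>M\<^esub> n) \<ominus>\<^bsub>M\<^esub> p \<odot>\<^bsub>M\<^esub> y"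
    using y_eq by simp
  also have "\<dots> = n"
    using pR y nM by (simp add: M.minus_eq M.a_ac M.r_neg1 M.r_neg2 M.r_neg)
  finally have "\<one> \<ominus> p \<in> colon_ideal R M N y"
    using n pR by (simp add: colon_ideal_def)
  then have "(\<one> \<ominus> p) \<oplus> p \<in> P"
    by (intro P.a_closed subsetD[OF P(3)] p)
  moreover have "(\<one> \<ominus> p) \<oplus> p = \<one>"
    using pR by (simp add: R.minus_eq R.a_assoc R.l_neg)
  ultimately show False
    using P(2) by simp
qed

text \<open>
  The submodule found is \<open>Q = PM + N\<close>, where \<open>P\<close> is a maximal ideal above \<open>(N : y)\<close> for some
  \<open>y \<notin> N\<close>. If \<open>m \<notin> Q\<close> and \<open>Rm = JM\<close>, then \<open>J\<close> is not contained in \<open>P\<close>, since otherwise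
  \<open>m \<in> PM\<close>. Hence \<open>P + J = R\<close>, and applying \<open>1 = p + j\<close> to \<open>M\<close> gives \<open>M = PM + JM \<subseteq> Q + Rm\<close>.
\<close>

lemma comaximal_above_multiplication:
  assumes mult: "multiplication_module R M" and N: "submodule N R M" "N \<noteq> carrier M"
  shows "\<exists>Q m. submodule Q R M \<and> N \<subseteq> Q \<and> Q \<noteq> carrier M \<and> m \<in> carrier M \<and>
    Q <+>\<^bsub>M\<^esub> cyclic_submodule R M m = carrier M"
proof -
  obtain y where y: "y \<in> carrier M" "y \<notin> N"
    using N(2) submoduleE(1)[OF N(1)] by blast
  have "\<one> \<notin> colon_ideal R M N y"
    using y by (simp add: colon_ideal_def)
  then obtain P where P: "maximalideal P R" "colon_ideal R M N y \<subseteq> P"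
    by (rule R.maximalideal_above[OF ideal_colon[OF N(1) y(1)]])
  interpret P: maximalideal P R by (rule P(1))
  have one: "\<one> \<notin> P"
    using P.one_imp_carrier P.I_notcarr by auto
  have PM: "submodule (ideal_smult R M P) R M"
    by (rule submodule_ideal_smult[OF P.a_subset])
  define Q where "Q = ideal_smult R M P <+>\<^bsub>M\<^esub> N"
  have Q: "submodule Q R M" "N \<subseteq> Q" "ideal_smult R M P \<subseteq> Q"
    unfolding Q_def
    by (rule submodule_sum[OF PM N(1)] right_subset_sum[OF PM N(1)] left_subset_sum[OF PM N(1)])+
  have proper: "Q \<noteq> carrier M"
    unfolding Q_def by (rule ideal_smult_sum_proper[OF mult N(1) y(1) P.is_ideal one P(2)])
  then obtain m where m: "m \<in> carrier M" "m \<notin> Q"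
    using submoduleE(1)[OF Q(1)] by blast
  have C: "submodule (cyclic_submodule R M m) R M"
    by (rule submodule_cyclic[OF m(1)])
  obtain J where J: "ideal J R" and Rm: "cyclic_submodule R M m = ideal_smult R M J"
    using mult C unfolding multiplication_module_def by blast
  have "\<not> J \<subseteq> P"
  proof
    assume "J \<subseteq> P"
    then have "ideal_smult R M J \<subseteq> ideal_smult R M P"
      by (intro ideal_smult_subset_submodule[OF PM] smult_in_ideal_smult) auto
    moreover have "m \<in> ideal_smult R M J"
      using cyclic_self[OF m(1)] Rm by simp
    ultimately show False
      using Q(3) m(2) by (simp add: subset_iff)
  qed
  moreover have "P \<subseteq> P <+>\<^bsub>R\<^esub> J"
  proof
    fix p assume p: "p \<in> P"
    then have "p = p \<oplus> \<zero>"
      using P.Icarr by simp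
    then show "p \<in> P <+>\<^bsub>R\<^esub> J"
      using p additive_subgroup.zero_closed[OF ideal.axioms(1)[OF J]] unfolding set_add_def' by blast
  qed
  moreover have "J \<subseteq> P <+>\<^bsub>R\<^esub> J"
  proof
    fix j assume j: "j \<in> J"
    then have "j = \<zero> \<oplus> j"
      using ideal.Icarr[OF J] by simp
    then show "j \<in> P <+>\<^bsub>R\<^esub> J"
      using j P.zero_closed unfolding set_add_def' by blast
  qed
  moreover have PJ: "ideal (P <+>\<^bsub>R\<^esub> J) R"
    by (rule R.add_ideals[OF P.is_ideal J])
  ultimately have "P <+>\<^bsub>R\<^esub> J = carrier R"
    using P.I_maximal[OF PJ] ideal.Icarr[OF PJ] by auto
  then have "\<one> \<in> P <+>\<^bsub>R\<^esub> J"
    using R.one_closed by simp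
  then obtain p j where pj: "p \<in> P" "j \<in> J" "\<one> = p \<oplus> j"
    unfolding set_add_def' by blast
  have "carrier M \<subseteq> Q <+>\<^bsub>M\<^esub> cyclic_submodule R M m"
  proof
    fix x assume x: "x \<in> carrier M"
    have pR: "p \<in> carrier R" and jR: "j \<in> carrier R"
      by (rule P.Icarr[OF pj(1)] ideal.Icarr[OF J pj(2)])+
    have "x = p \<odot>\<^bsub>M\<^esub> x \<oplus>\<^bsub>M\<^esub> j \<odot>\<^bsub>M\<^esub> x"
      using smult_l_distr[OF pR jR x] pj(3) smult_one[OF x] by simp
    moreover have "p \<odot>\<^bsub>M\<^esub> x \<in> Q"
      by (rule subsetD[OF Q(3) smult_in_ideal_smult[OF pj(1) x]])
    moreover have "j \<odot>\<^bsub>M\<^esub> x \<in> cyclic_submodule R M m"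
      using smult_in_ideal_smult[OF pj(2) x] Rm by simp
    ultimately show "x \<in> Q <+>\<^bsub>M\<^esub> cyclic_submodule R M m"
      using set_addI[of "p \<odot>\<^bsub>M\<^esub> x" Q "j \<odot>\<^bsub>M\<^esub> x" "cyclic_submodule R M m"] by simp
  qed
  then have "Q <+>\<^bsub>M\<^esub> cyclic_submodule R M m = carrier M"
    using submoduleE(1)[OF submodule_sum[OF Q(1) C]] by (intro equalityI)
  then show ?thesis
    using Q(1,2) proper m(1) by (intro exI conjI)
qed

section \<open>The topology\<close>

lemma coset_mono:
  assumes N: "submodule N R M" and K: "submodule K R M" "K \<subseteq> N"
    and x: "x \<in> m <+\<^bsub>M\<^esub> N" and m: "m \<in> carrier M"
  shows "x <+\<^bsub>M\<^esub> K \<subseteq> m <+\<^bsub>M\<^esub> N"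
proof
  fix z assume "z \<in> x <+\<^bsub>M\<^esub> K"
  then obtain n k where nk: "n \<in> N" "k \<in> K" "z = (m \<oplus>\<^bsub>M\<^esub> n) \<oplus>\<^bsub>M\<^esub> k"
    using x unfolding a_l_coset_def' by blast
  then have "z = m \<oplus>\<^bsub>M\<^esub> (n \<oplus>\<^bsub>M\<^esub> k)"
    using m submoduleE(1)[OF N] K(2) by (simp add: M.a_assoc subset_iff)
  moreover have "n \<oplus>\<^bsub>M\<^esub> k \<in> N"
    by (intro submoduleE(5)[OF N] nk(1) subsetD[OF K(2) nk(2)])
  ultimately show "z \<in> m <+\<^bsub>M\<^esub> N"
    unfolding a_l_coset_def' by blast
qed

lemma coset_self:
  assumes "submodule N R M" "m \<in> carrier M"
  shows "m \<in> m <+\<^bsub>M\<^esub> N"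
  using submodule_zero[OF assms(1)] M.r_zero[OF assms(2)] unfolding a_l_coset_def' by force

lemma coset_subset_carrier:
  assumes "submodule N R M" "m \<in> carrier M"
  shows "m <+\<^bsub>M\<^esub> N \<subseteq> carrier M"
  using submoduleE(1)[OF assms(1)] assms(2) unfolding a_l_coset_def' by auto

text \<open>
  A basic open coset may be re-based at any of its points, because \<open>N + Rm\<close> depends only on \<open>m\<close>
  modulo \<open>N\<close>. This lets two intersecting cosets share a base point.
\<close>

lemma comaximal_coset_element:
  assumes N: "submodule N R M" and m: "m \<in> carrier M" and x: "x \<in> m <+\<^bsub>M\<^esub> N"
    and com: "N <+>\<^bsub>M\<^esub> cyclic_submodule R M m = carrier M"
  shows "N <+>\<^bsub>M\<^esub> cyclic_submodule R M x = carrier M"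
proof -
  have xM: "x \<in> carrier M"
    using x coset_subset_carrier[OF N m] by blast
  let ?Q = "N <+>\<^bsub>M\<^esub> cyclic_submodule R M x"
  note C = submodule_cyclic[OF xM]
  have Q: "submodule ?Q R M" and N_Q: "N \<subseteq> ?Q"
    by (rule submodule_sum[OF N C] left_subset_sum[OF N C])+
  have "x \<in> ?Q"
    by (rule subsetD[OF right_subset_sum[OF N C] cyclic_self[OF xM]])
  moreover obtain n where n: "n \<in> N" "x = m \<oplus>\<^bsub>M\<^esub> n"
    using x unfolding a_l_coset_def' by blast
  ultimately have "m \<in> ?Q"
    using submodule_add_cancel[OF Q m subsetD[OF N_Q n(1)]] by simp
  then have "carrier M \<subseteq> ?Q"
    unfolding com[symmetric] by (intro sum_subset_submodule[OF Q N_Q] cyclic_subset_submodule[OF Q])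
  then show ?thesis
    using submoduleE(1)[OF Q] by (intro equalityI)
qed

lemma golomb_basisI:
  assumes "m \<in> carrier M" "submodule N R M" "N \<noteq> {\<zero>\<^bsub>M\<^esub>}"
    "N <+>\<^bsub>M\<^esub> cyclic_submodule R M m = carrier M"
  shows "m <+\<^bsub>M\<^esub> N \<in> golomb_basis R M"
  using assms unfolding golomb_basis_def by blast

lemma golomb_basisE:
  assumes "U \<in> golomb_basis R M"
  obtains m N where "U = m <+\<^bsub>M\<^esub> N" "m \<in> carrier M" "submodule N R M" "N \<noteq> {\<zero>\<^bsub>M\<^esub>}"
    "N <+>\<^bsub>M\<^esub> cyclic_submodule R M m = carrier M"
  using assms unfolding golomb_basis_def by blast

lemma carrier_coset:
  assumes m: "m \<in> carrier M"
  shows "m <+\<^bsub>M\<^esub> carrier M = carrier M"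
proof
  show "carrier M \<subseteq> m <+\<^bsub>M\<^esub> carrier M"
  proof
    fix x assume x: "x \<in> carrier M"
    then have "x = m \<oplus>\<^bsub>M\<^esub> (\<ominus>\<^bsub>M\<^esub> m \<oplus>\<^bsub>M\<^esub> x)"
      using m by (simp add: M.r_neg2)
    then show "x \<in> m <+\<^bsub>M\<^esub> carrier M"
      using x m unfolding a_l_coset_def' by blast
  qed
qed (rule coset_subset_carrier[OF carrier_is_submodule m])

lemma carrier_in_golomb_basis:
  assumes "carrier M \<noteq> {\<zero>\<^bsub>M\<^esub>}"
  shows "carrier M \<in> golomb_basis R M"
proof -
  note sub = carrier_is_submodule submodule_cyclic[OF M.zero_closed]
  have "carrier M <+>\<^bsub>M\<^esub> cyclic_submodule R M \<zero>\<^bsub>M\<^esub> = carrier M"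
    using left_subset_sum[OF sub] submoduleE(1)[OF submodule_sum[OF sub]] by (intro equalityI)
  then show ?thesis
    using golomb_basisI[OF M.zero_closed carrier_is_submodule assms]
      carrier_coset[OF M.zero_closed] by simp
qed

text \<open>
  The constant \<^const>\<open>topology\<close> is only meaningful on families closed under binary
  intersections. Around a common point \<open>x\<close> of \<open>m + N\<close> and \<open>m' + N'\<close> both cosets can be based at
  \<open>x\<close>, and the intersection property for \<open>X = Rx\<close> makes \<open>x + (N \<inter> N')\<close> a basic open set inside
  both.
\<close>

lemma openin_golomb_topology_full:
  assumes mi: "meet_irreducible_module R M"
    and Int: "\<And>N N' X. submodule N R M \<Longrightarrow> submodule N' R M \<Longrightarrow> submodule X R M \<Longrightarrow>
      N <+>\<^bsub>M\<^esub> X = carrier M \<Longrightarrow> N' <+>\<^bsub>M\<^esub> X = carrier M \<Longrightarrow> (N \<inter> N') <+>\<^bsub>M\<^esub> X = carrier M"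
  shows "openin (golomb_topology_full R M) = arbitrary union_of (\<lambda>U. U \<in> golomb_basis R M)"
proof -
  have "\<exists>B\<in>golomb_basis R M. x \<in> B \<and> B \<subseteq> U \<inter> V"
    if UV: "U \<in> golomb_basis R M" "V \<in> golomb_basis R M" and x: "x \<in> U \<inter> V" for U V x
  proof -
    obtain m N where U: "U = m <+\<^bsub>M\<^esub> N" "m \<in> carrier M" "submodule N R M" "N \<noteq> {\<zero>\<^bsub>M\<^esub>}"
      "N <+>\<^bsub>M\<^esub> cyclic_submodule R M m = carrier M"
      using golomb_basisE[OF UV(1)] .
    obtain m' N' where V: "V = m' <+\<^bsub>M\<^esub> N'" "m' \<in> carrier M" "submodule N' R M" "N' \<noteq> {\<zero>\<^bsub>M\<^esub>}"
      "N' <+>\<^bsub>M\<^esub> cyclic_submodule R M m' = carrier M"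
      using golomb_basisE[OF UV(2)] .
    have xU: "x \<in> m <+\<^bsub>M\<^esub> N" and xV: "x \<in> m' <+\<^bsub>M\<^esub> N'"
      using x U(1) V(1) by blast+
    have xM: "x \<in> carrier M"
      using xU coset_subset_carrier[OF U(3,2)] by blast
    have sub: "submodule (N \<inter> N') R M"
      by (rule submodule_Int[OF U(3) V(3)])
    have "x <+\<^bsub>M\<^esub> (N \<inter> N') \<in> golomb_basis R M"
    proof (rule golomb_basisI[OF xM sub])
      show "N \<inter> N' \<noteq> {\<zero>\<^bsub>M\<^esub>}"
        using mi U(3,4) V(3,4) unfolding meet_irreducible_module_def by blast
      show "(N \<inter> N') <+>\<^bsub>M\<^esub> cyclic_submodule R M x = carrier M"
        by (rule Int[OF U(3) V(3) submodule_cyclic[OF xM]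
              comaximal_coset_element[OF U(3,2) xU U(5)] comaximal_coset_element[OF V(3,2) xV V(5)]])
    qed
    moreover have "x <+\<^bsub>M\<^esub> (N \<inter> N') \<subseteq> U \<inter> V"
      using coset_mono[OF U(3) sub _ xU U(2)] coset_mono[OF V(3) sub _ xV V(2)] U(1) V(1) by simp
    ultimately show ?thesis
      using coset_self[OF sub xM] by blast
  qed
  then have "istopology (arbitrary union_of (\<lambda>U. U \<in> golomb_basis R M))"
    unfolding istopology_base_eq arbitrary_union_of_alt by blast
  then show ?thesis
    unfolding golomb_topology_full_def by (rule topology_inverse')
qed

lemma golomb_basis_simple:
  assumes "simple_module R M"
  shows "golomb_basis R M \<subseteq> {carrier M}"
proof
  fix U assume "U \<in> golomb_basis R M"
  then obtain m N where U: "U = m <+\<^bsub>M\<^esub> N" "m \<in> carrier M" "submodule N R M" "N \<noteq> {\<zero>\<^bsub>M\<^esub>}"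
    by (rule golomb_basisE)
  then have "N = carrier M"
    using assms unfolding simple_module_def by blast
  then show "U \<in> {carrier M}"
    using U carrier_coset by simp
qed

end

lemma indiscrete_space_subtopology:
  assumes "indiscrete_space X"
  shows "indiscrete_space (subtopology X S)"
  using assms unfolding indiscrete_space_def openin_subtopology topspace_subtopology by blast

lemma indiscrete_space_if_trivial_basis:
  assumes "openin X = arbitrary union_of (\<lambda>U. U \<in> \<B>)" "\<B> \<subseteq> {S}"
  shows "indiscrete_space X"
proof -
  have triv: "U = {} \<or> U = S" if "openin X U" for U
  proof -
    have "(arbitrary union_of (\<lambda>U. U \<in> \<B>)) U"
      using that assms(1) by simp
    then obtain \<U> where "\<U> \<subseteq> \<B>" "U = \<Union>\<U>"
      unfolding union_of_def by blast
    then show ?thesis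
      using assms(2) by (cases "\<U> = {}") auto
  qed
  show ?thesis
    unfolding indiscrete_space_def
  proof (intro allI impI)
    fix U assume U: "openin X U"
    then show "U = {} \<or> U = topspace X"
      using triv[OF U] triv[OF openin_topspace] openin_subset[OF U] by auto
  qed
qed

context Module.module
begin

text \<open>
  If \<open>Q\<close> is proper and \<open>Q + Rm = M\<close>, then \<open>m \<notin> Q\<close>, so \<open>m + Q\<close> is disjoint from \<open>Q\<close>. It
  therefore avoids \<open>0\<close>, which makes it open in the punctured space, and it also misses any nonzero
  \<open>q \<in> Q\<close>, which makes it a proper subset of that space.
\<close>

lemma simple_if_punctured_indiscrete:
  assumes nz: "carrier M \<noteq> {\<zero>\<^bsub>M\<^esub>}"
    and open_basis: "\<And>U. U \<in> golomb_basis R M \<Longrightarrow> openin (golomb_topology_full R M) U"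
    and above: "\<And>N. submodule N R M \<Longrightarrow> N \<noteq> carrier M \<Longrightarrow>
      \<exists>Q m. submodule Q R M \<and> N \<subseteq> Q \<and> Q \<noteq> carrier M \<and> m \<in> carrier M \<and>
        Q <+>\<^bsub>M\<^esub> cyclic_submodule R M m = carrier M"
    and ind: "indiscrete_space (golomb_topology R M)"
  shows "simple_module R M"
proof (rule ccontr)
  assume "\<not> simple_module R M"
  then obtain N where N: "submodule N R M" "N \<noteq> {\<zero>\<^bsub>M\<^esub>}" "N \<noteq> carrier M"
    using nz unfolding simple_module_def by blast
  then obtain Q m where Q: "submodule Q R M" "N \<subseteq> Q" "Q \<noteq> carrier M" and m: "m \<in> carrier M"
    and com: "Q <+>\<^bsub>M\<^esub> cyclic_submodule R M m = carrier M"
    using above[OF N(1,3)] by blast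
  obtain q where q: "q \<in> Q" "q \<noteq> \<zero>\<^bsub>M\<^esub>"
    using N(1,2) submodule_zero[OF N(1)] Q(2) by blast
  have "m \<notin> Q"
    using sum_subset_submodule[OF Q(1) subset_refl cyclic_subset_submodule[OF Q(1)]] com Q(3)
      submoduleE(1)[OF Q(1)] by auto
  then have disj: "(m <+\<^bsub>M\<^esub> Q) \<inter> Q = {}"
    using submodule_add_cancel[OF Q(1) m] unfolding a_l_coset_def' by blast
  let ?X = "golomb_topology_full R M" and ?S = "carrier M - {\<zero>\<^bsub>M\<^esub>}"
  have U: "openin ?X (m <+\<^bsub>M\<^esub> Q)"
    using q by (intro open_basis golomb_basisI[OF m Q(1) _ com]) auto
  have sub: "m <+\<^bsub>M\<^esub> Q \<subseteq> ?S"
    using coset_subset_carrier[OF Q(1) m] disj submodule_zero[OF Q(1)] by auto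
  have "openin (golomb_topology R M) (m <+\<^bsub>M\<^esub> Q)"
    unfolding golomb_topology_def openin_subtopology using U sub by blast
  moreover have "q \<in> topspace (golomb_topology R M)"
  proof -
    have "q \<in> carrier M"
      using q submoduleE(1)[OF Q(1)] by blast
    moreover have "openin ?X (carrier M)"
      by (rule open_basis[OF carrier_in_golomb_basis[OF nz]])
    ultimately show ?thesis
      using q(2) openin_subset unfolding golomb_topology_def topspace_subtopology by blast
  qed
  ultimately show False
    using ind coset_self[OF Q(1) m] disj q(1) unfolding indiscrete_space_def by blast
qed

end

theorem theorem4:
  fixes R :: "('a, 'c) ring_scheme" and M :: "('a, 'b, 'd) module_scheme"
  assumes "Module.module R M"
    and "\<one>\<^bsub>R\<^esub> \<noteq> \<zero>\<^bsub>R\<^esub>"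
    and "carrier M \<noteq> {\<zero>\<^bsub>M\<^esub>}"
    and "(meet_irreducible_module R M \<and> finitely_generated_module R M \<and>
            (\<forall>N. maximal_submodule N R M \<longrightarrow> strongly_irreducible_submodule N R M)) \<or>
         (meet_irreducible_module R M \<and> multiplication_module R M)"
  shows "(indiscrete_space (golomb_topology_full R M) \<longleftrightarrow> indiscrete_space (golomb_topology R M)) \<and>
         (indiscrete_space (golomb_topology R M) \<longleftrightarrow> simple_module R M)"
proof -
  interpret Module.module R M by (rule assms(1))
  have Int: "(N \<inter> N') <+>\<^bsub>M\<^esub> X = carrier M"
    if "submodule N R M" "submodule N' R M" "submodule X R M"
      "N <+>\<^bsub>M\<^esub> X = carrier M" "N' <+>\<^bsub>M\<^esub> X = carrier M" for N N' X
    using assms(4) Int_comaximal_strongly_irreducible[OF _ _ that]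
      Int_comaximal_multiplication[OF _ that] by auto
  have above: "\<exists>Q m. submodule Q R M \<and> N \<subseteq> Q \<and> Q \<noteq> carrier M \<and> m \<in> carrier M \<and>
      Q <+>\<^bsub>M\<^esub> cyclic_submodule R M m = carrier M"
    if "submodule N R M" "N \<noteq> carrier M" for N
    using assms(4)
  proof
    assume "meet_irreducible_module R M \<and> finitely_generated_module R M \<and>
      (\<forall>N. maximal_submodule N R M \<longrightarrow> strongly_irreducible_submodule N R M)"
    then show ?thesis
      by (intro comaximal_above_finitely_generated that) simp
  next
    assume "meet_irreducible_module R M \<and> multiplication_module R M"
    then show ?thesis
      by (intro comaximal_above_multiplication that) simp
  qed
  have openin: "openin (golomb_topology_full R M) = arbitrary union_of (\<lambda>U. U \<in> golomb_basis R M)"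
    by (rule openin_golomb_topology_full[OF _ Int]) (use assms(4) in auto)
  have "simple_module R M \<Longrightarrow> indiscrete_space (golomb_topology_full R M)"
    by (rule indiscrete_space_if_trivial_basis[OF openin golomb_basis_simple])
  moreover have "indiscrete_space (golomb_topology_full R M) \<Longrightarrow> indiscrete_space (golomb_topology R M)"
    unfolding golomb_topology_def by (rule indiscrete_space_subtopology)
  moreover have "indiscrete_space (golomb_topology R M) \<Longrightarrow> simple_module R M"
  proof (rule simple_if_punctured_indiscrete[OF assms(3)])
    show "openin (golomb_topology_full R M) U" if "U \<in> golomb_basis R M" for U
      unfolding openin using that by (rule arbitrary_union_of_inc)
  qed (rule above)
  ultimately show ?thesis
    by blast
qed

end
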